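(* Let $k\ge 2$ and let $F,F'$ be minimally unsatisfiable 2-CNFs of deficiency $k$. Then the set of isomorphisms $f:F\to F'$ (as maps from the literals of $F$ to the literals of $F'$) equals the set of digraph isomorphisms $f:\mathrm{idg}(F)\to\mathrm{idg}(F')$ (as maps between vertex sets).
   Context: Literals are variables and their complements; a clause is a finite set of literals without complementary pair; a 2-CNF is a finite set of clauses of size at most 2. Deficiency $\delta(F)=|F|-n(F)$, $n(F)$ the number of variables. Minimally unsatisfiable: unsatisfiable, and removing any clause makes it satisfiable. An isomorphism $F\to F'$ is a bijection $f$ from the literals of $F$ to those of $F'$ with $f(\overline x)=\overline{f(x)}$ and $\{f(C):C\in F\}=F'$. For a 2-CNF $F$ without empty clause, $\mathrm{idg}(F)$ has vertex set the literals over variables of $F$, arcs $(\overline x,x)$ for unit-clauses $\{x\}$, and arcs $(\overline x,y),(\overline y,x)$ for clauses $\{x,y\}$, $x\neq y$. A digraph isomorphism is a bijection of vertex sets mapping the arc set exactly onto the arc set. *)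

theory Defs
  imports "Graph_Theory.Pair_Digraph" "HOL-Library.FuncSet"
begin

datatype 'v literal = Pos 'v | Neg 'v

fun var_of :: "'v literal \<Rightarrow> 'v" where
  "var_of (Pos v) = v"
| "var_of (Neg v) = v"

fun complement :: "'v literal \<Rightarrow> 'v literal" where
  "complement (Pos v) = Neg v"
| "complement (Neg v) = Pos v"

type_synonym 'v clause_set = "'v literal set set"

definition is_clause :: "'v literal set \<Rightarrow> bool" where
  "is_clause C \<longleftrightarrow> finite C \<and> (\<forall>x\<in>C. complement x \<notin> C)"

definition two_cnf :: "'v clause_set \<Rightarrow> bool" where
  "two_cnf F \<longleftrightarrow> finite F \<and> (\<forall>C\<in>F. is_clause C \<and> card C \<le> 2)"

definition vars :: "'v clause_set \<Rightarrow> 'v set" where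
  "vars F = var_of ` \<Union>F"

text \<open>Both literals over every variable of \<open>F\<close>, not only those occurring in some clause.\<close>
definition lits :: "'v clause_set \<Rightarrow> 'v literal set" where
  "lits F = {x. var_of x \<in> vars F}"

definition deficiency :: "'v clause_set \<Rightarrow> int" where
  "deficiency F = int (card F) - int (card (vars F))"

fun lit_true :: "('v \<Rightarrow> bool) \<Rightarrow> 'v literal \<Rightarrow> bool" where
  "lit_true \<phi> (Pos v) = \<phi> v"
| "lit_true \<phi> (Neg v) = (\<not> \<phi> v)"

definition satisfiable :: "'v clause_set \<Rightarrow> bool" where
  "satisfiable F \<longleftrightarrow> (\<exists>\<phi>. \<forall>C\<in>F. \<exists>x\<in>C. lit_true \<phi> x)"

definition minimally_unsatisfiable :: "'v clause_set \<Rightarrow> bool" where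
  "minimally_unsatisfiable F \<longleftrightarrow>
     \<not> satisfiable F \<and> (\<forall>C\<in>F. satisfiable (F - {C}))"

text \<open>A map with domain \<open>A\<close> is represented by a function in \<open>extensional A\<close>, so that
  equality of such functions is equality of maps on \<open>A\<close>.\<close>

definition cnf_isos :: "'v clause_set \<Rightarrow> 'w clause_set \<Rightarrow> ('v literal \<Rightarrow> 'w literal) set" where
  "cnf_isos F F' = {f \<in> extensional (lits F).
     bij_betw f (lits F) (lits F') \<and>
     (\<forall>x\<in>lits F. f (complement x) = complement (f x)) \<and>
     {f ` C | C. C \<in> F} = F'}"

text \<open>Meant for 2-CNFs without the empty clause.  By symmetry in \<open>x\<close> and \<open>y\<close>, a clause
  \<open>{x, y}\<close> contributes both of its arcs to the second set.\<close>
definition idg :: "'v clause_set \<Rightarrow> 'v literal pair_pre_digraph" where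
  "idg F = \<lparr> pverts = lits F,
     parcs = {(complement x, x) | x. {x} \<in> F}
           \<union> {(complement x, y) | x y. x \<noteq> y \<and> {x, y} \<in> F} \<rparr>"

definition digraph_isos :: "'a pair_pre_digraph \<Rightarrow> 'b pair_pre_digraph \<Rightarrow> ('a \<Rightarrow> 'b) set" where
  "digraph_isos G H = {f \<in> extensional (pverts G).
     bij_betw f (pverts G) (pverts H) \<and>
     {(f u, f v) | u v. (u, v) \<in> parcs G} = parcs H}"

end

theory Submission
  imports Defs
begin

text \<open>
  An isomorphism of implication digraphs pulls the complementation of \<open>F'\<close> back to a second
  fixed-point-free skew-symmetry \<open>\<tau>\<close> of \<open>idg F\<close>, besides complementation \<open>\<sigma>\<close>, with respect to which
  \<open>idg F\<close> is again minimally contradictory; the point is that \<open>\<tau> = \<sigma>\<close>.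

  Deficiency at least 2 excludes unit clauses, so no arc joins a vertex to its mate. There is a
  simple cycle \<open>b\<close> through some vertex and its mate, and by minimality \<open>b\<close> and \<open>\<sigma> b\<close> together
  contain all arcs. Whether a simple cycle contains a complementary pair depends only on
  its length, so \<open>b\<close> and \<open>\<tau> b\<close> contain all arcs as well. This forces \<open>\<sigma> b\<close> and \<open>\<tau> b\<close> to be the
  same reversed cycle, whence \<open>\<tau> (b i) = \<sigma> (b (i + c))\<close> for a constant \<open>c\<close>. Call \<open>(i, a)\<close> a chord
  if \<open>b a = \<sigma> (b i)\<close>. Chords are stable under \<open>(i, a) \<mapsto> (i + c, a - c)\<close>, while minimality makes
  the cycle symmetric between two chords that do not cross. Unless \<open>c\<close> is a multiple of
  the length, this yields an interval of \<open>b\<close> reversed by \<open>\<sigma>\<close> or \<open>\<tau>\<close>, and in its middle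
  there is a fixed point or an arc between mates.
\<close>

section \<open>Minimally unsatisfiable 2-CNFs\<close>

lemma complement_complement [simp]: "complement (complement x) = x"
  by (cases x) auto

lemma complement_neq [simp]: "complement x \<noteq> x" "x \<noteq> complement x"
  by (cases x; simp)+

lemma var_of_complement [simp]: "var_of (complement x) = var_of x"
  by (cases x) auto

lemma lit_true_complement [simp]: "lit_true \<phi> (complement x) \<longleftrightarrow> \<not> lit_true \<phi> x"
  by (cases x) auto

lemma var_of_eq_iff: "var_of x = var_of y \<longleftrightarrow> x = y \<or> x = complement y"
  by (cases x; cases y) auto

lemma ex_assignment_update:
  "\<exists>\<psi>. lit_true \<psi> x \<and> (\<forall>y. y \<noteq> x \<and> y \<noteq> complement x \<longrightarrow> lit_true \<psi> y = lit_true \<phi> y)"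
proof (cases x)
  case (Pos v)
  show ?thesis
    by (rule exI[of _ "\<phi>(v := True)"], intro conjI allI impI, simp add: Pos,
        case_tac y) (auto simp: Pos)
next
  case (Neg v)
  show ?thesis
    by (rule exI[of _ "\<phi>(v := False)"], intro conjI allI impI, simp add: Neg,
        case_tac y) (auto simp: Neg)
qed

text \<open>A model of \<open>F - {C}\<close> satisfies \<open>D\<close> if \<open>D\<close> differs
  from \<open>C\<close>, hence also its superset \<open>C\<close>.\<close>

lemma minimally_unsatisfiable_antichain:
  assumes "minimally_unsatisfiable F" "C \<in> F" "D \<in> F" "D \<subseteq> C"
  shows "C = D"
proof (rule ccontr)
  assume "C \<noteq> D"
  obtain \<phi> where \<phi>: "\<forall>B\<in>F - {C}. \<exists>x\<in>B. lit_true \<phi> x"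
    using assms unfolding minimally_unsatisfiable_def satisfiable_def by blast
  then have "\<exists>x\<in>C. lit_true \<phi> x"
    using assms \<open>C \<noteq> D\<close> by blast
  with \<phi> have "satisfiable F"
    unfolding satisfiable_def by blast
  with assms show False
    unfolding minimally_unsatisfiable_def by blast
qed

text \<open>Unit propagation is a bijection on the remaining clauses and preserves minimal
  unsatisfiability; it removes one clause and one variable, and it creates a new small clause.\<close>

lemma deficiency_eq_1_if_small_clause:
  assumes "two_cnf F" "minimally_unsatisfiable F" "C \<in> F" "card C \<le> 1"
  shows "deficiency F = 1"
  using assms
proof (induction "card (vars F)" arbitrary: F C rule: less_induct)
  case less
  have finF: "finite F" and clause: "\<And>C. C \<in> F \<Longrightarrow> is_clause C \<and> card C \<le> 2"
    using less.prems unfolding two_cnf_def by auto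
  have finC: "\<And>C. C \<in> F \<Longrightarrow> finite C"
    using clause unfolding is_clause_def by blast
  have finvars: "finite (vars F)"
    unfolding vars_def using finF finC by auto
  note antichain = minimally_unsatisfiable_antichain[OF less.prems(2)]
  have unsat: "\<not> satisfiable F"
    using less.prems(2) unfolding minimally_unsatisfiable_def by blast
  consider "C = {}" | v where "C = {v}"
    using less.prems(3,4) finC card_1_singletonE by (metis card_0_eq le_eq_less_or_eq less_one)
  then show ?case
  proof cases
    case 1
    then have "F = {{}}"
      using antichain less.prems(3) by blast
    then show ?thesis
      by (simp add: deficiency_def vars_def)
  next
    case (2 v)
    then have vF: "{v} \<in> F"
      using less.prems by simp
    have v_unique: "C = {v}" if "C \<in> F" "v \<in> C" for C
      using antichain[OF that(1) vF] that(2) by blast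
    define R where "R = F - {{v}}"
    define r where "r = (\<lambda>C. C - {complement v})"
    have R_iff: "C \<in> R \<longleftrightarrow> C \<in> F \<and> v \<notin> C" for C
      using v_unique unfolding R_def by blast
    \<comment> \<open>Clauses with equal images differ at most in \<open>complement v\<close>, so
      one contains the other.\<close>
    have inj: "inj_on r R"
    proof (rule inj_onI)
      fix C D assume "C \<in> R" "D \<in> R" "r C = r D"
      then have "C \<subseteq> D \<or> D \<subseteq> C"
        unfolding r_def by blast
      then show "C = D"
        using antichain \<open>C \<in> R\<close> \<open>D \<in> R\<close> unfolding R_iff by metis
    qed
    have cnf: "two_cnf (r ` R)"
      unfolding two_cnf_def
    proof (intro conjI ballI)
      show "finite (r ` R)"
        using finF by (simp add: R_def)
    next
      fix D assume "D \<in> r ` R"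
      then obtain C where C: "C \<in> F" "D = C - {complement v}"
        using R_iff unfolding r_def by blast
      then show "is_clause D"
        using clause[of C] unfolding is_clause_def by auto
      have "card D \<le> card C"
        using C finC by (simp add: card_mono)
      then show "card D \<le> 2"
        using C clause[of C] by simp
    qed
    have mu: "minimally_unsatisfiable (r ` R)"
      unfolding minimally_unsatisfiable_def
    proof (intro conjI ballI)
      show "\<not> satisfiable (r ` R)"
      proof
        assume "satisfiable (r ` R)"
        then obtain \<phi> where \<phi>: "\<forall>C\<in>R. \<exists>x\<in>r C. lit_true \<phi> x"
          unfolding satisfiable_def by blast
        obtain \<psi> where \<psi>: "lit_true \<psi> v"
          "\<And>y. y \<noteq> v \<Longrightarrow> y \<noteq> complement v \<Longrightarrow> lit_true \<psi> y = lit_true \<phi> y"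
          using ex_assignment_update[of v \<phi>] by blast
        have "\<exists>x\<in>C. lit_true \<psi> x" if "C \<in> F" for C
        proof (cases "v \<in> C")
          case True
          then show ?thesis using \<psi>(1) by blast
        next
          case False
          then have "C \<in> R"
            using that by (simp add: R_iff)
          then obtain x where "x \<in> r C" "lit_true \<phi> x"
            using \<phi> by auto
          then show ?thesis
            using \<psi>(2)[of x] False unfolding r_def by auto
        qed
        with unsat show False
          unfolding satisfiable_def by blast
      qed
    next
      fix D assume "D \<in> r ` R"
      then obtain C where C: "C \<in> F" "v \<notin> C" "D = r C"
        using R_iff by blast
      then obtain \<phi> where \<phi>: "\<forall>B\<in>F - {C}. \<exists>x\<in>B. lit_true \<phi> x"
        using less.prems(2) unfolding minimally_unsatisfiable_def satisfiable_def by blast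
      then have "lit_true \<phi> v"
        using vF C by (metis Diff_iff singletonD singletonI)
      then have sat: "\<exists>x\<in>r B. lit_true \<phi> x" if "B \<in> F - {C}" for B
        using \<phi> that unfolding r_def by (metis Diff_iff lit_true_complement singletonD)
      have "\<exists>x\<in>A. lit_true \<phi> x" if "A \<in> r ` R - {D}" for A
      proof -
        from that obtain B where "B \<in> F - {C}" "A = r B"
          using C(3) by (auto simp: R_def)
        then show ?thesis
          using sat by simp
      qed
      then show "satisfiable (r ` R - {D})"
        unfolding satisfiable_def by blast
    qed
    have vars: "vars (r ` R) = vars F - {var_of v}"
    proof
      show "vars (r ` R) \<subseteq> vars F - {var_of v}"
      proof
        fix u assume "u \<in> vars (r ` R)"
        then obtain C x where "C \<in> R" "x \<in> r C" "u = var_of x"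
          unfolding vars_def by auto
        then have "C \<in> F" "x \<in> C" "x \<noteq> v" "x \<noteq> complement v" "u = var_of x"
          using R_iff[of C] by (auto simp: r_def)
        then show "u \<in> vars F - {var_of v}"
          unfolding vars_def by (auto simp: var_of_eq_iff)
      qed
    next
      show "vars F - {var_of v} \<subseteq> vars (r ` R)"
      proof
        fix u assume "u \<in> vars F - {var_of v}"
        then obtain C x where x: "C \<in> F" "x \<in> C" "u = var_of x" "var_of x \<noteq> var_of v"
          unfolding vars_def by blast
        then have "v \<notin> C"
          using v_unique by blast
        then have "C \<in> R" "x \<in> r C"
          using x R_iff[of C] by (auto simp: r_def)
        with x show "u \<in> vars (r ` R)"
          unfolding vars_def by blast
      qed
    qed
    have v_vars: "var_of v \<in> vars F"
      unfolding vars_def using vF by blast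
    \<comment> \<open>If \<open>complement v\<close> occurred nowhere, a model of \<open>R\<close>
      could be altered to make \<open>v\<close> true and would satisfy \<open>F\<close>. The literal
      lost by \<open>D\<close> makes \<open>r D\<close> the small clause for the induction.\<close>
    obtain D where D: "D \<in> F" "complement v \<in> D"
    proof (rule ccontr)
      assume "\<not> thesis"
      then have no: "\<And>D. D \<in> F \<Longrightarrow> complement v \<notin> D"
        using that by blast
      obtain \<phi> where \<phi>: "\<forall>B\<in>R. \<exists>x\<in>B. lit_true \<phi> x"
        using less.prems(2) vF unfolding minimally_unsatisfiable_def satisfiable_def R_def by blast
      obtain \<psi> where \<psi>: "lit_true \<psi> v"
        "\<And>y. y \<noteq> v \<Longrightarrow> y \<noteq> complement v \<Longrightarrow> lit_true \<psi> y = lit_true \<phi> y"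
        using ex_assignment_update[of v \<phi>] by blast
      have "\<exists>x\<in>B. lit_true \<psi> x" if "B \<in> F" for B
        using \<phi> \<psi> no[OF that] that R_iff[of B] by metis
      with unsat show False
        unfolding satisfiable_def by blast
    qed
    have "v \<notin> D"
      using clause[OF D(1)] D(2) unfolding is_clause_def by blast
    then have "r D \<in> r ` R"
      using D R_iff[of D] by blast
    moreover have "card (r D) \<le> 1"
      using clause[OF D(1)] D(2) unfolding r_def is_clause_def by auto
    moreover have "card (vars (r ` R)) < card (vars F)"
      unfolding vars using finvars v_vars by (rule card_Diff1_less)
    ultimately have "deficiency (r ` R) = 1"
      using less.hyps cnf mu by blast
    moreover have "card (r ` R) = card F - 1"
      using inj vF by (simp add: card_image R_def)
    moreover have "card F > 0"
      using finF vF card_gt_0_iff by blast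
    moreover have "card (vars F) > 0"
      using finvars v_vars card_gt_0_iff by blast
    ultimately show ?thesis
      unfolding deficiency_def vars using v_vars by (simp add: of_nat_diff)
  qed
qed

section \<open>Implication arcs and satisfiability\<close>

lemma finite_lits:
  assumes "two_cnf F"
  shows "finite (lits F)"
proof -
  have "finite (vars F)"
    using assms unfolding vars_def two_cnf_def is_clause_def by auto
  moreover have "lits F \<subseteq> Pos ` vars F \<union> Neg ` vars F"
    unfolding lits_def by (auto intro: literal.exhaust simp: image_iff) (metis var_of.elims)
  ultimately show ?thesis
    by (meson finite_UnI finite_imageI finite_subset)
qed

lemma complement_lits_iff [simp]: "complement x \<in> lits F \<longleftrightarrow> x \<in> lits F"
  by (simp add: lits_def)

lemma in_litsI: "x \<in> C \<Longrightarrow> C \<in> F \<Longrightarrow> x \<in> lits F"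
  by (auto simp: lits_def vars_def)

text \<open>One criterion covers both kinds of arcs: for \<open>w = complement u\<close> the set
  \<open>{complement u, w}\<close> collapses to a unit clause.\<close>

lemma idg_arc_iff: "(u, w) \<in> parcs (idg F) \<longleftrightarrow> {complement u, w} \<in> F"
proof
  assume "(u, w) \<in> parcs (idg F)"
  then show "{complement u, w} \<in> F"
    by (auto simp: idg_def)
next
  assume *: "{complement u, w} \<in> F"
  have "u = complement (complement u)"
    by simp
  with * show "(u, w) \<in> parcs (idg F)"
    unfolding idg_def by (cases "w = complement u") force+
qed

lemma idg_skew: "(u, w) \<in> parcs (idg F) \<Longrightarrow> (complement w, complement u) \<in> parcs (idg F)"
  by (simp add: idg_arc_iff insert_commute)

lemma idg_skew_rtrancl:
  "(u, w) \<in> (parcs (idg F))\<^sup>* \<Longrightarrow> (complement w, complement u) \<in> (parcs (idg F))\<^sup>*"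
  by (induction rule: rtrancl_induct) (auto intro: idg_skew converse_rtrancl_into_rtrancl)

text \<open>A satisfying assignment propagates truth along arcs, so mutually reachable literals have
  the same truth value.\<close>

lemma satisfiable_no_contradiction:
  assumes "satisfiable F"
  shows "\<not> ((v, complement v) \<in> (parcs (idg F))\<^sup>* \<and> (complement v, v) \<in> (parcs (idg F))\<^sup>*)"
proof -
  obtain \<phi> where \<phi>: "\<forall>C\<in>F. \<exists>x\<in>C. lit_true \<phi> x"
    using assms unfolding satisfiable_def by blast
  have "lit_true \<phi> u \<Longrightarrow> lit_true \<phi> w" if "(u, w) \<in> (parcs (idg F))\<^sup>*" for u w
    using that
  proof (induction rule: rtrancl_induct)
    case (step y z)
    then have "{complement y, z} \<in> F" by (simp add: idg_arc_iff)
    then show ?case using \<phi> step by fastforce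
  qed
  then show ?thesis
    by (metis lit_true_complement)
qed

text \<open>A maximal consistent set of literals closed under implication decides every variable,
  hence is a satisfying assignment.\<close>

lemma unsatisfiable_contradiction:
  assumes cnf: "two_cnf F" and unsat: "\<not> satisfiable F" and pairs: "\<forall>C\<in>F. \<exists>x y. C = {x, y}"
  shows "\<exists>v\<in>lits F. (v, complement v) \<in> (parcs (idg F))\<^sup>* \<and> (complement v, v) \<in> (parcs (idg F))\<^sup>*"
proof (rule ccontr)
  define E where "E = parcs (idg F)"
  assume "\<not> ?thesis"
  then have no: "\<And>v. v \<in> lits F \<Longrightarrow> \<not> ((v, complement v) \<in> E\<^sup>* \<and> (complement v, v) \<in> E\<^sup>*)"
    unfolding E_def by blast
  note skew = idg_skew_rtrancl[of _ _ F, folded E_def]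
  have E_lits: "y \<in> lits F" if "(x, y) \<in> E" for x y
    using that in_litsI[of y "{complement x, y}" F] by (simp add: E_def idg_arc_iff)
  have E_rtrancl_lits: "y \<in> lits F" if "(x, y) \<in> E\<^sup>*" "x \<in> lits F" for x y
    using that by (induction rule: rtrancl_induct) (auto intro: E_lits)
  define \<T> where
    "\<T> = {T \<in> Pow (lits F). (\<forall>x\<in>T. complement x \<notin> T) \<and> (\<forall>x y. x \<in> T \<and> (x, y) \<in> E \<longrightarrow> y \<in> T)}"
  have "finite \<T>" "\<T> \<noteq> {}"
    using finite_lits[OF cnf] unfolding \<T>_def by auto
  from finite_has_maximal[OF this] obtain T where T: "T \<in> \<T>" and
    max: "\<And>T'. T' \<in> \<T> \<Longrightarrow> T \<subseteq> T' \<Longrightarrow> T = T'"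
    by blast
  have T_sub: "T \<subseteq> lits F" and T_cons: "\<And>x. x \<in> T \<Longrightarrow> complement x \<notin> T"
    and T_closed: "\<And>x y. x \<in> T \<Longrightarrow> (x, y) \<in> E \<Longrightarrow> y \<in> T"
    using T unfolding \<T>_def by auto
  have T_rtrancl: "y \<in> T" if "(x, y) \<in> E\<^sup>*" "x \<in> T" for x y
    using that by (induction rule: rtrancl_induct) (auto intro: T_closed)
  have extend: "u \<in> T \<or> complement u \<in> T" if u: "u \<in> lits F" "(u, complement u) \<notin> E\<^sup>*" for u
  proof (rule ccontr)
    assume un: "\<not> (u \<in> T \<or> complement u \<in> T)"
    define T' where "T' = T \<union> E\<^sup>* `` {u}"
    \<comment> \<open>A path from \<open>u\<close> to \<open>complement x\<close> mirrors to one
      from \<open>x\<close> to \<open>complement u\<close>. In \<open>1\<close> this would put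
      \<open>complement u\<close> into the closed set \<open>T\<close>; in \<open>2\<close> it would
      extend a path from \<open>u\<close> to \<open>x\<close> to one from \<open>u\<close> to
      \<open>complement u\<close>.\<close>
    have 1: "complement x \<notin> E\<^sup>* `` {u}" if "x \<in> T" for x
      using skew[of u "complement x"] T_rtrancl[of x "complement u"] that un by auto
    have 2: "complement x \<notin> E\<^sup>* `` {u}" if "x \<in> E\<^sup>* `` {u}" for x
      using skew[of u "complement x"] that u by (auto dest: rtrancl_trans)
    have "T' \<in> \<T>"
      unfolding \<T>_def
    proof (intro CollectI conjI ballI allI impI)
      show "T' \<in> Pow (lits F)"
        using T_sub E_rtrancl_lits u unfolding T'_def by blast
    next
      fix x assume "x \<in> T'"
      then show "complement x \<notin> T'"
        using 1[of x] 2[of x] 1[of "complement x"] T_cons unfolding T'_def by auto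
    next
      fix x y assume "x \<in> T' \<and> (x, y) \<in> E"
      then show "y \<in> T'"
        using T_closed unfolding T'_def by (auto intro: rtrancl_into_rtrancl)
    qed
    then have "T = T'"
      using max unfolding T'_def by blast
    then show False
      using un unfolding T'_def by blast
  qed
  have total: "u \<in> T \<or> complement u \<in> T" if "u \<in> lits F" for u
    using extend[of u] extend[of "complement u"] no[OF that] that
    by (metis complement_complement complement_lits_iff)
  define \<phi> where "\<phi> = (\<lambda>v. Pos v \<in> T)"
  have true: "lit_true \<phi> x" if "x \<in> T" for x
    using that T_cons[of x] by (cases x) (auto simp: \<phi>_def)
  have "\<exists>x\<in>C. lit_true \<phi> x" if CF: "C \<in> F" for C
  proof -
    obtain x y where C: "C = {x, y}"
      using bspec[OF pairs CF] by (elim exE)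
    then have "(complement x, y) \<in> E" "x \<in> lits F"
      using CF in_litsI[of x "{x, y}" F] by (simp_all add: E_def idg_arc_iff)
    then have "x \<in> T \<or> y \<in> T"
      using total[of x] T_closed[of "complement x" y] by auto
    then show ?thesis
      using true C by auto
  qed
  with unsat show False
    unfolding satisfiable_def by blast
qed

section \<open>Minimally contradictory skew-symmetric digraphs\<close>

text \<open>All integers serve as indices, so intervals of the cycle may wrap around. The last
  conjunct encodes both the period \<open>L\<close> and the distinctness of the vertices within one
  period.\<close>

definition simple_cycle :: "('a \<times> 'a) set \<Rightarrow> int \<Rightarrow> (int \<Rightarrow> 'a) \<Rightarrow> bool" where
  "simple_cycle E L b \<longleftrightarrow>
     L > 0 \<and> (\<forall>i. (b i, b (i + 1)) \<in> E) \<and> (\<forall>i j. b i = b j \<longleftrightarrow> L dvd j - i)"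

lemma relpow_segment:
  assumes "\<forall>i<n. (f i, f (Suc i)) \<in> E" "i \<le> j" "j \<le> n"
  shows "(f i, f j) \<in> E ^^ (j - i)"
  unfolding relpow_fun_conv using assms by (intro exI[of _ "\<lambda>k. f (i + k)"]) auto

lemma relpow_trans: "(x, y) \<in> E ^^ m \<Longrightarrow> (y, z) \<in> E ^^ n \<Longrightarrow> (x, z) \<in> E ^^ (m + n)"
  by (metis relcomp.relcompI relpow_add)

lemma rtrancl_segment:
  fixes b :: "int \<Rightarrow> 'a"
  assumes "i \<le> j" "\<And>p. i \<le> p \<Longrightarrow> p < j \<Longrightarrow> (b p, b (p + 1)) \<in> R"
  shows "(b i, b j) \<in> R\<^sup>*"
  using assms by (induction rule: int_ge_induct) (auto intro: rtrancl_into_rtrancl)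

lemma walk_concat:
  assumes "(x, y) \<in> E ^^ m" "(y, z) \<in> E ^^ n"
  shows "\<exists>f. f 0 = x \<and> f m = y \<and> f (m + n) = z \<and> (\<forall>i<m + n. (f i, f (Suc i)) \<in> E)"
proof -
  obtain f where f: "f 0 = x" "f m = y" "\<forall>i<m. (f i, f (Suc i)) \<in> E"
    using assms(1) unfolding relpow_fun_conv by blast
  obtain g where g: "g 0 = y" "g n = z" "\<forall>i<n. (g i, g (Suc i)) \<in> E"
    using assms(2) unfolding relpow_fun_conv by blast
  define h where "h = (\<lambda>i. if i \<le> m then f i else g (i - m))"
  have "(h i, h (Suc i)) \<in> E" if "i < m + n" for i
  proof -
    consider "i < m" | "i = m" | "i > m" by linarith
    then show ?thesis
    proof cases
      case 3
      then have "i - m < n" "Suc i - m = Suc (i - m)" using that by auto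
      then show ?thesis using 3 g(3) by (simp add: h_def)
    qed (use f g that in \<open>auto simp: h_def\<close>)
  qed
  moreover have "h 0 = x" "h m = y" "h (m + n) = z"
    using f g by (auto simp: h_def)
  ultimately show ?thesis by blast
qed

lemma simple_cycle_of_walk:
  fixes f :: "nat \<Rightarrow> 'a"
  assumes "L > 0" "f L = f 0" "\<forall>i<L. (f i, f (Suc i)) \<in> E" "inj_on f {..<L}"
  shows "simple_cycle E (int L) (\<lambda>i. f (nat (i mod int L)))"
  unfolding simple_cycle_def
proof (intro conjI allI)
  show "int L > 0" using assms by simp
next
  fix i :: int
  define k where "k = nat (i mod int L)"
  have k: "k < L" "i mod int L = int k"
    using assms(1) by (auto simp: k_def nat_less_iff)
  have "(i + 1) mod int L = (int k + 1) mod int L"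
    using k(2) by (metis mod_add_left_eq)
  also have "\<dots> = (if Suc k = L then 0 else int (Suc k))"
    using k(1) by (auto simp: add.commute)
  finally have "f (nat ((i + 1) mod int L)) = f (Suc k)"
    using assms(2) by (auto simp: nat_add_distrib)
  then show "(f (nat (i mod int L)), f (nat ((i + 1) mod int L))) \<in> E"
    using assms(3) k by simp
next
  fix i j :: int
  have "f (nat (i mod int L)) = f (nat (j mod int L)) \<longleftrightarrow> nat (i mod int L) = nat (j mod int L)"
    using assms(1,4) by (intro inj_on_eq_iff) (auto simp: nat_less_iff)
  also have "\<dots> \<longleftrightarrow> i mod int L = j mod int L"
    using assms(1) by (metis Euclidean_Rings.pos_mod_sign nat_eq_iff of_nat_0_less_iff)
  also have "\<dots> \<longleftrightarrow> int L dvd j - i"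
    by (metis mod_eq_dvd_iff)
  finally show "f (nat (i mod int L)) = f (nat (j mod int L)) \<longleftrightarrow> int L dvd j - i" .
qed

lemma simple_cycle_card:
  assumes "simple_cycle E L b"
  shows "range b = b ` {0..<L}" "int (card (range b)) = L"
proof -
  have L: "L > 0" and eq: "\<And>i j. b i = b j \<longleftrightarrow> L dvd j - i"
    using assms unfolding simple_cycle_def by auto
  show 1: "range b = b ` {0..<L}"
  proof -
    have "b i \<in> b ` {0..<L}" for i
    proof -
      have "b i = b (i mod L)"
        unfolding eq by (metis dvd_minus_mod minus_diff_eq dvd_minus_iff)
      then show ?thesis using L by auto
    qed
    then show ?thesis by blast
  qed
  have "inj_on b {0..<L}"
  proof (rule inj_onI)
    fix i j assume ij: "i \<in> {0..<L}" "j \<in> {0..<L}" "b i = b j"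
    then have "i mod L = j mod L"
      using eq by (metis mod_eq_dvd_iff)
    then show "i = j" using ij by simp
  qed
  then show "int (card (range b)) = L"
    using 1 L by (simp add: card_image)
qed

text \<open>Abstracted from literals so that two skew-symmetries can be compared on one digraph. In
  \<open>minimal\<close> an arc is deleted together with its mirror image; for \<open>idg\<close>
  these are the arcs of one clause.\<close>

locale skew_graph =
  fixes V :: "'a set" and E :: "('a \<times> 'a) set" and \<sigma> :: "'a \<Rightarrow> 'a"
  assumes finite_V: "finite V"
    and Field_E: "Field E = V"
    and closed: "v \<in> V \<Longrightarrow> \<sigma> v \<in> V"
    and invol [simp]: "v \<in> V \<Longrightarrow> \<sigma> (\<sigma> v) = v"
    and no_fixpoint: "v \<in> V \<Longrightarrow> \<sigma> v \<noteq> v"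
    and no_unit: "(v, \<sigma> v) \<notin> E"
    and skew: "(u, w) \<in> E \<Longrightarrow> (\<sigma> w, \<sigma> u) \<in> E"
    and contradictory: "\<exists>v\<in>V. (v, \<sigma> v) \<in> E\<^sup>* \<and> (\<sigma> v, v) \<in> E\<^sup>*"
    and minimal: "(u, w) \<in> E \<Longrightarrow> v \<in> V \<Longrightarrow>
      (v, \<sigma> v) \<in> (E - {(u, w), (\<sigma> w, \<sigma> u)})\<^sup>* \<Longrightarrow>
      (\<sigma> v, v) \<in> (E - {(u, w), (\<sigma> w, \<sigma> u)})\<^sup>* \<Longrightarrow> False"
begin

lemma arc_in_V: "(u, w) \<in> E \<Longrightarrow> u \<in> V" "(u, w) \<in> E \<Longrightarrow> w \<in> V"
  using Field_E by (auto simp: Field_def)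

lemma relpow_skew:
  assumes "(u, w) \<in> E ^^ n"
  shows "(\<sigma> w, \<sigma> u) \<in> E ^^ n"
  using assms
proof (induction n arbitrary: w)
  case (Suc n)
  then obtain y where "(u, y) \<in> E ^^ n" "(y, w) \<in> E" by auto
  then show ?case using Suc.IH skew relpow_Suc_I2 by metis
qed auto

lemma relpow_in_V: "(u, w) \<in> E ^^ n \<Longrightarrow> u \<in> V \<Longrightarrow> w \<in> V"
  by (induction n arbitrary: w) (auto dest: arc_in_V)

text \<open>A shortest closed walk through a vertex \<open>v\<close> and its mate \<open>\<sigma> v\<close> need not be simple: its two halves
  may meet in a vertex \<open>u\<close>.  Replacing the path from \<open>v\<close> through \<open>u\<close> to \<open>\<sigma> v\<close> by its mirror image
  under \<open>\<sigma>\<close> then produces a closed walk of the same length visiting \<open>u\<close>, \<open>v\<close>, \<open>\<sigma> u\<close>, \<open>\<sigma> v\<close> in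
  this cyclic order, and that one is simple.\<close>

lemma crossing_walk_simple:
  assumes min: "\<And>v m n. v \<in> V \<Longrightarrow> (v, \<sigma> v) \<in> E ^^ m \<Longrightarrow> (\<sigma> v, v) \<in> E ^^ n \<Longrightarrow> L \<le> m + n"
    and V: "u \<in> V" "v \<in> V"
    and f: "f 0 = u" "f w = v" "f (w + y) = \<sigma> u" "f (w + y + x) = \<sigma> v" "f L = u"
    and L: "L = w + y + x + z" and arcs: "\<forall>i<L. (f i, f (Suc i)) \<in> E"
    and pos: "y + z > 0" "x + w > 0"
  shows "inj_on f {..<L}"
proof -
  note seg = relpow_segment[OF arcs]
  have inV: "f i \<in> V" if "i \<le> L" for i
    using relpow_in_V[OF seg[of 0 i]] that V f by simp
  have "f i \<noteq> f j" if "i < j" "j < L" for i j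
  proof
    assume eq: "f i = f j"
    define t where "t = f i"
    have t: "t \<in> V" using inV that by (simp add: t_def)
    have jump: "(f a, f c) \<in> E ^^ (i - a + (c - j))" if "a \<le> i" "j \<le> c" "c \<le> L" for a c
      using relpow_trans[OF seg[of a i], of "f c" "c - j"] seg[of j c] eq that \<open>i < j\<close> \<open>j < L\<close> by simp
    \<comment> \<open>In the first four cases both indices lie on one path between a vertex and its
      mate, and cutting out the part between them shortens the walk. In the last two they lie in
      opposite quarters; mirrored pieces then give a closed walk through \<open>t\<close> and
      \<open>\<sigma> t\<close> of length \<open>w + x\<close> or \<open>y + z\<close>.\<close>
    consider "j \<le> w + y" | "i \<ge> w + y" | "w \<le> i" "j \<le> w + y + x" | "i \<le> w" "w + y + x \<le> j"
      | "i < w" "w + y < j" "j < w + y + x" | "w < i" "i < w + y" "w + y + x < j"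
      by linarith
    then show False
    proof cases
      case 1
      have "(u, \<sigma> u) \<in> E ^^ (i - 0 + (w + y - j))"
        using jump[of 0 "w + y"] 1 L f by simp
      moreover have "(\<sigma> u, u) \<in> E ^^ (L - (w + y))"
        using seg[of "w + y" L] L f by simp
      ultimately have "L \<le> (i - 0 + (w + y - j)) + (L - (w + y))"
        by (rule min[OF V(1)])
      then show False using 1 L that by simp
    next
      case 2
      have "(\<sigma> u, u) \<in> E ^^ (i - (w + y) + (L - j))"
        using jump[of "w + y" L] 2 L f that by simp
      moreover have "(u, \<sigma> u) \<in> E ^^ (w + y)"
        using seg[of 0 "w + y"] L f by simp
      ultimately have "L \<le> (w + y) + (i - (w + y) + (L - j))"
        using min[OF V(1)] by blast
      then show False using 2 L that by simp
    next
      case 3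
      have "(v, \<sigma> v) \<in> E ^^ (i - w + (w + y + x - j))"
        using jump[of w "w + y + x"] 3 L f that by simp
      moreover have "(\<sigma> v, v) \<in> E ^^ ((L - (w + y + x)) + w)"
        using relpow_trans[OF seg[of "w + y + x" L], of v w] seg[of 0 w] L f by simp
      ultimately have "L \<le> (i - w + (w + y + x - j)) + ((L - (w + y + x)) + w)"
        by (rule min[OF V(2)])
      then show False using 3 L that by simp
    next
      case 4
      have "(v, \<sigma> v) \<in> E ^^ (y + x)"
        using seg[of w "w + y + x"] L f by simp
      moreover have "(\<sigma> v, v) \<in> E ^^ ((j - (w + y + x)) + (w - i))"
        using relpow_trans[OF seg[of "w + y + x" j], of v "w - i"] seg[of i w] 4 L f that eq by simp
      ultimately have "L \<le> (y + x) + ((j - (w + y + x)) + (w - i))"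
        by (rule min[OF V(2)])
      then show False using 4 L that by simp
    next
      case 5
      have *: "(u, t) \<in> E ^^ i" "(t, v) \<in> E ^^ (w - i)"
        using seg[of 0 i] seg[of i w] 5 L f by (simp_all add: t_def)
      have "(\<sigma> u, t) \<in> E ^^ (j - (w + y))" "(t, \<sigma> v) \<in> E ^^ (w + y + x - j)"
        using seg[of "w + y" j] seg[of j "w + y + x"] 5 L f eq by (simp_all add: t_def)
      from this[THEN relpow_skew]
      have **: "(\<sigma> t, u) \<in> E ^^ (j - (w + y))" "(v, \<sigma> t) \<in> E ^^ (w + y + x - j)"
        using V by simp_all
      have "L \<le> ((w - i) + (w + y + x - j)) + ((j - (w + y)) + i)"
        by (intro min[OF t] relpow_trans[OF *(2) **(2)] relpow_trans[OF **(1) *(1)])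
      then show False using 5 L that pos by simp
    next
      case 6
      have *: "(\<sigma> v, t) \<in> E ^^ (j - (w + y + x))" "(t, u) \<in> E ^^ (L - j)"
        using seg[of "w + y + x" j] seg[of j L] 6 L f that eq by (simp_all add: t_def)
      have "(v, t) \<in> E ^^ (i - w)" "(t, \<sigma> u) \<in> E ^^ (w + y - i)"
        using seg[of w i] seg[of i "w + y"] 6 L f by (simp_all add: t_def)
      from this[THEN relpow_skew]
      have **: "(\<sigma> t, \<sigma> v) \<in> E ^^ (i - w)" "(u, \<sigma> t) \<in> E ^^ (w + y - i)"
        using V by simp_all
      have "L \<le> ((L - j) + (w + y - i)) + ((i - w) + (j - (w + y + x)))"
        by (intro min[OF t] relpow_trans[OF *(2) **(2)] relpow_trans[OF **(1) *(1)])
      then show False using 6 L that pos by simp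
    qed
  qed
  then show ?thesis
    by (metis inj_onI lessThan_iff linorder_neqE_nat)
qed

lemma ex_simple_contradictory_cycle:
  "\<exists>L b i j. simple_cycle E L b \<and> b j = \<sigma> (b i)"
proof -
  define P where "P = (\<lambda>L. \<exists>v\<in>V. \<exists>m n. (v, \<sigma> v) \<in> E ^^ m \<and> (\<sigma> v, v) \<in> E ^^ n \<and> L = m + n)"
  define L where "L = (LEAST L. P L)"
  have "\<exists>L. P L"
    using contradictory unfolding P_def by (metis rtrancl_imp_relpow)
  then have "P L"
    unfolding L_def by (rule LeastI_ex)
  have min: "L \<le> m + n" if "v \<in> V" "(v, \<sigma> v) \<in> E ^^ m" "(\<sigma> v, v) \<in> E ^^ n" for v m n
    unfolding L_def by (rule Least_le) (use that P_def in blast)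
  obtain v m n where v: "v \<in> V" "(v, \<sigma> v) \<in> E ^^ m" "(\<sigma> v, v) \<in> E ^^ n" and L: "L = m + n"
    using \<open>P L\<close> unfolding P_def by blast
  have mn: "m > 0" "n > 0"
    using v no_fixpoint by (metis gr0I relpow_0_E)+
  obtain f where f: "f 0 = v" "f m = \<sigma> v" "f (m + n) = v"
    and arcs: "\<forall>i<m + n. (f i, f (Suc i)) \<in> E"
    using walk_concat[OF v(2,3)] by blast
  have result: ?thesis if "h L = h 0" "\<forall>i<L. (h i, h (Suc i)) \<in> E" "inj_on h {..<L}"
    "a < L" "c < L" "h c = \<sigma> (h a)" for h a c
  proof -
    have "simple_cycle E (int L) (\<lambda>i. h (nat (i mod int L)))"
      using that mn L by (intro simple_cycle_of_walk) auto
    then show ?thesis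
      using that by (intro exI[of _ "int L"] exI[of _ "\<lambda>i. h (nat (i mod int L))"]
          exI[of _ "int a"] exI[of _ "int c"]) simp
  qed
  show ?thesis
  proof (cases "inj_on f {..<L}")
    case True
    then show ?thesis
      using result[of f 0 m] f arcs L mn by simp
  next
    case False
    then obtain i j where ij: "i < j" "j < L" "f i = f j"
      by (metis inj_onI lessThan_iff linorder_neqE_nat)
    note seg = relpow_segment[OF arcs]
    \<comment> \<open>A repetition within one half could be cut out, contradicting the choice of
      \<open>L\<close>; so the two halves meet in \<open>u\<close>.\<close>
    have "i < m"
    proof (rule ccontr)
      assume "\<not> i < m"
      then have "(\<sigma> v, v) \<in> E ^^ ((i - m) + (L - j))"
        using relpow_trans[OF seg[of m i], of v "L - j"] seg[of j L] ij L f by simp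
      from min[OF v(1,2) this] show False
        using ij \<open>\<not> i < m\<close> L by simp
    qed
    moreover have "m < j"
    proof (rule ccontr)
      assume "\<not> m < j"
      then have "(v, \<sigma> v) \<in> E ^^ (i + (m - j))"
        using relpow_trans[OF seg[of 0 i], of "\<sigma> v" "m - j"] seg[of j m] ij L f by simp
      from min[OF v(1) this v(3)] show False
        using ij \<open>\<not> m < j\<close> L by simp
    qed
    moreover define u where "u = f i"
    ultimately have p: "(v, u) \<in> E ^^ i" "(u, \<sigma> v) \<in> E ^^ (m - i)"
      "(\<sigma> v, u) \<in> E ^^ (j - m)" "(u, v) \<in> E ^^ (L - j)"
      using seg[of 0 i] seg[of i m] seg[of m j] seg[of j L] f ij L by simp_all
    have u: "u \<in> V"
      using relpow_in_V p(1) v(1) by blast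
    have q: "(v, \<sigma> u) \<in> E ^^ (m - i)" "(\<sigma> u, \<sigma> v) \<in> E ^^ i"
      using relpow_skew[OF p(2)] relpow_skew[OF p(1)] v u by simp_all
    \<comment> \<open>The lengths, in this order, of the quarters \<open>u\<close> to
      \<open>v\<close>, \<open>v\<close> to \<open>\<sigma> u\<close>, \<open>\<sigma> u\<close> to
      \<open>\<sigma> v\<close> and \<open>\<sigma> v\<close> to \<open>u\<close> of the rerouted
      walk.\<close>
    define w y x z where "w = L - j" "y = m - i" "x = i" "z = j - m"
    note def = this
    have sum: "L = w + y + x + z"
      using def ij L \<open>i < m\<close> \<open>m < j\<close> by simp
    obtain g1 where g1: "g1 0 = u" "g1 w = v" "g1 (w + y) = \<sigma> u"
      "\<forall>i<w + y. (g1 i, g1 (Suc i)) \<in> E"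
      using walk_concat[OF p(4) q(1)] def by blast
    obtain g2 where g2: "g2 0 = \<sigma> u" "g2 x = \<sigma> v" "g2 (x + z) = u"
      "\<forall>i<x + z. (g2 i, g2 (Suc i)) \<in> E"
      using walk_concat[OF q(2) p(3)] def by blast
    define g where "g = (\<lambda>k. if k \<le> w + y then g1 k else g2 (k - (w + y)))"
    have g: "g 0 = u" "g w = v" "g (w + y) = \<sigma> u" "g (w + y + x) = \<sigma> v" "g L = u"
      using g1 g2 sum by (auto simp: g_def)
    have g_arcs: "\<forall>i<L. (g i, g (Suc i)) \<in> E"
    proof (intro allI impI)
      fix k assume "k < L"
      consider "k < w + y" | "k = w + y" | "k > w + y" by linarith
      then show "(g k, g (Suc k)) \<in> E"
      proof cases
        case 3
        then have "k - (w + y) < x + z" "Suc k - (w + y) = Suc (k - (w + y))"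
          using \<open>k < L\<close> sum by auto
        then show ?thesis using 3 g2(4) by (simp add: g_def)
      qed (use g1 g2 \<open>k < L\<close> sum in \<open>auto simp: g_def\<close>)
    qed
    have "inj_on g {..<L}"
      using crossing_walk_simple[OF min u v(1) g sum g_arcs] def ij \<open>i < m\<close> by simp
    moreover have "w + y < L" "0 < L"
      using sum def(4) \<open>m < j\<close> by linarith+
    ultimately show ?thesis
      using result[of g 0 "w + y"] g g_arcs by metis
  qed
qed


section \<open>Symmetries of a fixed simple cycle\<close>

context
  fixes L b
  assumes cyc: "simple_cycle E L b"
begin

lemma cycle_pos: "L > 0"
  and cycle_arc: "(b i, b (i + 1)) \<in> E"
  and cycle_eq_iff: "b i = b j \<longleftrightarrow> L dvd j - i"
  using cyc unfolding simple_cycle_def by auto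

lemma cycle_in_V: "b i \<in> V"
  using cycle_arc arc_in_V by blast

lemma cycle_add_period: "b (i + L * k) = b i" "b (i - L * k) = b i"
  by (simp_all add: cycle_eq_iff)

text \<open>The middle of an interval of even length would be a fixed point; for odd length it would
  be an arc between mates.\<close>

lemma no_reversed_interval:
  assumes "i \<le> i'" "\<And>t. 0 \<le> t \<Longrightarrow> t \<le> i' - i \<Longrightarrow> b (i' - t) = \<sigma> (b (i + t))"
  shows False
proof (cases "even (i' - i)")
  case True
  then obtain k where k: "i' - i = 2 * k" by blast
  then have "i' - k = i + k" "0 \<le> k" "k \<le> i' - i" using assms(1) by auto
  then show False
    using assms(2)[of k] no_fixpoint[OF cycle_in_V] by metis
next
  case False
  then obtain k where k: "i' - i = 2 * k + 1" by (rule oddE)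
  then have "i' - k = i + k + 1" "0 \<le> k" "k \<le> i' - i" using assms(1) by auto
  then show False
    using assms(2)[of k] no_unit cycle_arc[of "i + k"] by metis
qed

text \<open>Adding enough periods to \<open>j\<close> moves it past \<open>i\<close>.\<close>

lemma cycle_reachable:
  assumes "\<And>p. (b p, b (p + 1)) \<in> R"
  shows "(b i, b j) \<in> R\<^sup>*"
proof -
  have "i - j \<le> \<bar>i - j\<bar>"
    by simp
  also have "\<dots> \<le> L * \<bar>i - j\<bar>"
    using cycle_pos mult_right_mono[of 1 L "\<bar>i - j\<bar>"] by simp
  finally have "i \<le> j + L * \<bar>i - j\<bar>"
    by (simp only: diff_le_eq add.commute)
  from rtrancl_segment[OF this, of b R] assms show ?thesis
    by (simp add: cycle_add_period)
qed

text \<open>Otherwise the whole cycle, with its pair of mates, would survive the deletion of the arc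
  and its mirror image.\<close>

lemma cycle_covers:
  assumes "b j = \<sigma> (b i)" "(u, w) \<in> E"
  shows "(\<exists>k. b k = u \<and> b (k + 1) = w) \<or> (\<exists>k. b k = \<sigma> w \<and> b (k + 1) = \<sigma> u)"
proof (rule ccontr)
  assume "\<not> ?thesis"
  then have "(b p, b (p + 1)) \<in> E - {(u, w), (\<sigma> w, \<sigma> u)}" for p
    using cycle_arc[of p] by auto
  from cycle_reachable[OF this] show False
    using minimal[OF assms(2) cycle_in_V[of i]] assms(1) by metis
qed

text \<open>The cycle and its mirror image have \<open>L\<close> vertices each; if they meet, they
  cover \<open>V\<close> with an overlap, and if not, they need \<open>2 * L\<close> vertices. The
  criterion does not mention \<open>\<sigma>\<close>, so it transfers to a second
  skew-symmetry.\<close>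

lemma contradictory_cycle_iff: "(\<exists>i j. b j = \<sigma> (b i)) \<longleftrightarrow> int (card V) < 2 * L"
proof -
  have sub: "range b \<subseteq> V" "\<sigma> ` range b \<subseteq> V"
    using cycle_in_V closed by auto
  have fin: "finite (range b)"
    using sub finite_V finite_subset by blast
  have inj: "inj_on \<sigma> (range b)"
    using sub invol by (metis inj_onI subsetD)
  have card: "int (card (range b)) = L" "int (card (\<sigma> ` range b)) = L"
    using simple_cycle_card(2)[OF cyc] inj by (simp_all add: card_image)
  have "int (card V) < 2 * L" if "b j = \<sigma> (b i)" for i j
  proof -
    have "v \<in> range b \<union> \<sigma> ` range b" if "v \<in> V" for v
    proof -
      obtain u where "(u, v) \<in> E \<or> (v, u) \<in> E"
        using \<open>v \<in> V\<close> Field_E by (auto simp: Field_def)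
      then obtain k where "b k = v \<or> b k = \<sigma> v"
        using cycle_covers[OF \<open>b j = \<sigma> (b i)\<close>] by blast
      then show ?thesis
        using \<open>v \<in> V\<close> by (metis UnI1 UnI2 imageI invol rangeI)
    qed
    then have "card V \<le> card (range b \<union> \<sigma> ` range b)"
      using fin by (intro card_mono) auto
    moreover have "card (range b \<inter> \<sigma> ` range b) > 0"
      using fin that by (subst card_gt_0_iff) (metis IntI empty_iff finite_Int rangeI imageI)
    moreover have "card (range b) + card (\<sigma> ` range b)
        = card (range b \<union> \<sigma> ` range b) + card (range b \<inter> \<sigma> ` range b)"
      using fin by (intro card_Un_Int) auto
    ultimately show ?thesis using card by linarith
  qed
  moreover have "2 * L \<le> int (card V)" if "\<not> (\<exists>i j. b j = \<sigma> (b i))"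
  proof -
    have "card (range b \<union> \<sigma> ` range b) = card (range b) + card (\<sigma> ` range b)"
      using fin that by (intro card_Un_disjoint) auto
    moreover have "card (range b \<union> \<sigma> ` range b) \<le> card V"
      using sub finite_V by (intro card_mono) auto
    ultimately show ?thesis using card by linarith
  qed
  ultimately show ?thesis by (metis linorder_not_less)
qed

text \<open>If the chords joining \<open>b i\<close>, \<open>b j\<close> to their mates do not cross, the path from
  \<open>b j'\<close> to \<open>b i'\<close> can be bypassed by the mirror image of the path from \<open>b i\<close> to \<open>b j\<close>;
  by minimality the bypassed arcs are then the mirror images themselves.\<close>

lemma noncrossing_chords:
  assumes ord: "i \<le> j" "j \<le> j'" "j' \<le> i'" "i' \<le> i + L"
    and chords: "b i' = \<sigma> (b i)" "b j' = \<sigma> (b j)"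
    and t: "0 \<le> t" "t \<le> j - i"
  shows "b (i' - t) = \<sigma> (b (i + t))"
proof -
  have mate: "\<exists>q. b q = \<sigma> (b (p + 1)) \<and> b (q + 1) = \<sigma> (b p)" if p: "j' \<le> p" "p < i'" for p
  proof (rule ccontr)
    assume no: "\<not> ?thesis"
    define R where "R = E - {(b p, b (p + 1)), (\<sigma> (b (p + 1)), \<sigma> (b p))}"
    have arc: "(b q, b (q + 1)) \<in> R" if "\<not> L dvd q - p" for q
      using cycle_arc[of q] no that unfolding R_def by (auto simp: cycle_eq_iff dvd_diff_commute)
    have not_dvd: "\<not> L dvd q - p" if "i \<le> q \<and> q < j' \<or> i' \<le> q \<and> q < i + L" for q
    proof
      assume "L dvd q - p"
      moreover have "\<bar>q - p\<bar> < L" "q - p \<noteq> 0"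
        using that p ord by auto
      ultimately show False
        using dvd_imp_le_int[of "q - p" L] cycle_pos by auto
    qed
    have R_skew: "(\<sigma> w, \<sigma> u) \<in> R" if "(u, w) \<in> R" for u w
    proof -
      have "(u, w) \<in> E"
        using that by (simp add: R_def)
      then have "u \<in> V" "w \<in> V"
        using arc_in_V by auto
      then have "\<sigma> w = x \<longleftrightarrow> w = \<sigma> x" "\<sigma> u = x \<longleftrightarrow> u = \<sigma> x" if "x \<in> V" for x
        using that by auto
      then show ?thesis
        using that skew \<open>(u, w) \<in> E\<close> by (auto simp: R_def cycle_in_V closed)
    qed
    have R_skew_rtrancl: "(\<sigma> w, \<sigma> u) \<in> R\<^sup>*" if "(u, w) \<in> R\<^sup>*" for u w
      using that by (induction rule: rtrancl_induct) (auto intro: R_skew converse_rtrancl_into_rtrancl)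
    have A: "(b i, b j) \<in> R\<^sup>*" and C: "(b j, b j') \<in> R\<^sup>*" and D: "(b i', b (i + L)) \<in> R\<^sup>*"
      using ord by (auto intro!: rtrancl_segment arc not_dvd)
    have "b (i + L) = b i"
      using cycle_add_period(1)[of i 1] by simp
    \<comment> \<open>The detour from \<open>b j'\<close> runs along the mirrored path to
      \<open>b i'\<close>, on to \<open>b (i + L) = b i\<close>, and then to
      \<open>b j\<close>.\<close>
    then have "(\<sigma> (b j), b j) \<in> R\<^sup>*"
      using R_skew_rtrancl[OF A] D A chords by (metis rtrancl_trans)
    then show False
      using C chords minimal[OF cycle_arc[of p] cycle_in_V[of j]] unfolding R_def by simp
  qed
  have rev: "b (i' - s) = \<sigma> (b (i + s))" if "0 \<le> s" "s \<le> i' - j'" for s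
    using that
  proof (induction s rule: int_ge_induct)
    case base
    then show ?case using chords by simp
  next
    case (step s)
    obtain q where q: "b q = \<sigma> (b (i' - s))" "b (q + 1) = \<sigma> (b (i' - s - 1))"
      using mate[of "i' - s - 1"] step by auto
    have "b (i' - s) = \<sigma> (b (i + s))"
      using step by simp
    then have "b q = b (i + s)"
      using q(1) by (simp add: cycle_in_V)
    then have "b (q + 1) = b (i + s + 1)"
      by (simp add: cycle_eq_iff)
    then show ?case
      using q(2) cycle_in_V by (metis add.assoc diff_diff_eq invol)
  qed
  \<comment> \<open>So far the reflection has the length of the interval from \<open>j'\<close> to
    \<open>i'\<close>; comparing its end with the chord at \<open>j\<close> shows that the interval
    from \<open>i\<close> to \<open>j\<close> is equally long.\<close>
  have "\<sigma> (b (i + (i' - j'))) = \<sigma> (b j)"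
    using rev[of "i' - j'"] ord chords by simp
  then have dvd: "L dvd j - i - (i' - j')"
    using cycle_in_V by (metis cycle_eq_iff diff_diff_eq invol)
  have "j < j'"
    using ord chords no_fixpoint[OF cycle_in_V] by (metis order_le_less)
  then have "\<bar>j - i - (i' - j')\<bar> < L"
    using ord by linarith
  then have "j - i = i' - j'"
    using dvd dvd_imp_le_int[of "j - i - (i' - j')" L] cycle_pos by fastforce
  then show ?thesis using rev t by simp
qed

end

end

section \<open>Uniqueness of the skew-symmetry\<close>

locale skew_graph_pair = S: skew_graph V E \<sigma> + T: skew_graph V E \<tau>
  for V :: "'a set" and E \<sigma> \<tau>
begin

context
  fixes L b i0 j0
  assumes cyc: "simple_cycle E L b" and chord0: "b j0 = \<sigma> (b i0)"
begin

private lemmas pos = S.cycle_pos[OF cyc]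
private lemmas arc = S.cycle_arc[OF cyc]
private lemmas eq_iff = S.cycle_eq_iff[OF cyc]
private lemmas in_V [simp] = S.cycle_in_V[OF cyc]
private lemmas add_period = S.cycle_add_period[OF cyc]

private lemma succ_eq: "b i = b j \<Longrightarrow> b (i + 1) = b (j + 1)"
  by (simp add: eq_iff)

private lemma pred_eq: "b (i + 1) = b (j + 1) \<Longrightarrow> b i = b j"
  by (simp add: eq_iff)

lemma arc_cases_S:
  assumes "(u, w) \<in> E"
  shows "(\<exists>k. u = b k \<and> w = b (k + 1)) \<or> (\<exists>k. u = \<sigma> (b (k + 1)) \<and> w = \<sigma> (b k))"
  using S.cycle_covers[OF cyc chord0 assms] S.arc_in_V[OF assms] S.invol by metis

text \<open>By the length criterion the same cycle also contains a pair of \<tau>-mates, so it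
  covers all arcs with respect to \<tau> as well.\<close>

lemma arc_cases_T:
  assumes "(u, w) \<in> E"
  shows "(\<exists>k. u = b k \<and> w = b (k + 1)) \<or> (\<exists>k. u = \<tau> (b (k + 1)) \<and> w = \<tau> (b k))"
proof -
  obtain i j where "b j = \<tau> (b i)"
    using S.contradictory_cycle_iff[OF cyc] T.contradictory_cycle_iff[OF cyc] chord0 by blast
  from T.cycle_covers[OF cyc this assms] show ?thesis
    using T.arc_in_V[OF assms] T.invol by metis
qed

text \<open>Otherwise \<sigma> would reverse the cycle onto itself, which
  \<open>no_reversed_interval\<close> excludes.\<close>

lemma ex_arc_off_cycle: "\<exists>s. \<forall>k. \<not> (b k = \<sigma> (b (s + 1)) \<and> b (k + 1) = \<sigma> (b s))"
proof (rule ccontr)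
  assume "\<not> ?thesis"
  then have all: "\<exists>k. b k = \<sigma> (b (s + 1)) \<and> b (k + 1) = \<sigma> (b s)" for s
    by blast
  obtain h where "b h = \<sigma> (b 0)"
    using all by blast
  moreover have "b (h mod L) = b h"
    by (simp add: eq_iff)
  moreover define h' where "h' = h mod L"
  ultimately have h': "b h' = \<sigma> (b 0)" "0 \<le> h'"
    using pos by auto
  have "b (h' - t) = \<sigma> (b t)" if "0 \<le> t" for t
    using that
  proof (induction t rule: int_ge_induct)
    case (step t)
    obtain k where k: "b k = \<sigma> (b (t + 1))" "b (k + 1) = \<sigma> (b t)"
      using all by blast
    then have "b k = b (h' - (t + 1))"
      using step pred_eq[of k "h' - (t + 1)"] by simp
    with k show ?case by simp
  qed (use h' in simp)
  then show False
    using S.no_reversed_interval[OF cyc, of 0 h'] h' by simp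
qed

text \<open>Both \<open>\<sigma>\<close> and \<open>\<tau>\<close> map the cycle to a reversed cycle that contains all arcs
  off the cycle, and these two cycles have the same successor at each common vertex.\<close>

lemma images_differ_by_rotation: "\<exists>c. \<forall>i. \<tau> (b i) = \<sigma> (b (i + c))"
proof -
  obtain s where s: "\<And>k. \<not> (b k = \<sigma> (b (s + 1)) \<and> b (k + 1) = \<sigma> (b s))"
    using ex_arc_off_cycle by blast
  \<comment> \<open>The mirror image of the arc at \<open>s\<close> is off the cycle, hence is the
    \<tau>-image of a cycle arc; this aligns the two images at one vertex.\<close>
  obtain r where r: "\<tau> (b r) = \<sigma> (b s)"
    using arc_cases_T[OF S.skew[OF arc[of s]]] s by metis
  have agree: "\<tau> (b (r - t)) = \<sigma> (b (s - t))" if "0 \<le> t" for t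
    using that
  proof (induction t rule: int_ge_induct)
    case (step t)
    define x where "x = \<tau> (b (r - t))"
    have x: "x = \<sigma> (b (s - t))"
      using step by (simp add: x_def)
    have T_arc: "(x, \<tau> (b (r - (t + 1)))) \<in> E"
      using T.skew[OF arc[of "r - (t + 1)"]] by (simp add: x_def)
    have S_arc: "(x, \<sigma> (b (s - (t + 1)))) \<in> E"
      using S.skew[OF arc[of "s - (t + 1)"]] by (simp add: x)
    \<comment> \<open>Either one of the two arcs leaving \<open>x\<close> belongs to the other image
      as well, where successors are unique, or both lie on \<open>b\<close>.\<close>
    consider k where "x = \<sigma> (b (k + 1))" "\<tau> (b (r - (t + 1))) = \<sigma> (b k)"
      | k where "x = \<tau> (b (k + 1))" "\<sigma> (b (s - (t + 1))) = \<tau> (b k)"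
      | k l where "x = b k" "\<tau> (b (r - (t + 1))) = b (k + 1)"
          "x = b l" "\<sigma> (b (s - (t + 1))) = b (l + 1)"
      using arc_cases_S[OF T_arc] arc_cases_T[OF S_arc] by blast
    then show ?case
    proof cases
      case 1
      then have "b (k + 1) = b (s - t)"
        using x S.invol in_V by metis
      then show ?thesis
        using 1 pred_eq[of k "s - (t + 1)"] by simp
    next
      case 2
      then have "b (k + 1) = b (r - t)"
        using x_def T.invol in_V by metis
      then show ?thesis
        using 2 pred_eq[of k "r - (t + 1)"] by simp
    next
      case 3
      then show ?thesis using succ_eq by metis
    qed
  qed (use r in simp)
  have "\<tau> (b i) = \<sigma> (b (i + (s - r)))" for i
  proof -
    \<comment> \<open>\<open>agree\<close> only runs backwards from \<open>r\<close>, so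
      \<open>i\<close> is replaced by a congruent index \<open>r - t\<close> with nonnegative
      \<open>t\<close>.\<close>
    define t where "t = (r - i) mod L"
    have t: "t \<ge> 0" "L dvd (r - i) - t"
      using pos by (auto simp: t_def)
    have "b i = b (r - t)" "b (i + (s - r)) = b (s - t)"
      using t(2) unfolding eq_iff by (simp_all add: algebra_simps)
    then show ?thesis
      using agree[OF t(1)] by simp
  qed
  then show ?thesis by blast
qed

section \<open>Chords under rotation by \<open>c\<close>\<close>

context
  fixes c
  assumes rotation: "\<tau> (b i) = \<sigma> (b (i + c))"
begin

private lemma chord_sym: "b a = \<sigma> (b i) \<Longrightarrow> b i = \<sigma> (b a)"
  by simp

private lemma chord_period: "b a = \<sigma> (b i) \<Longrightarrow> b (a + L * k) = \<sigma> (b (i + L * l))"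
  by (simp add: add_period)

text \<open>By the rotation, \<open>\<tau> (b (a - c)) = \<sigma> (b a) = b i\<close>.\<close>

lemma chord_T:
  assumes "b a = \<sigma> (b i)"
  shows "\<tau> (b i) = b (a - c)"
proof -
  have "\<tau> (b (a - c)) = b i"
    using rotation[of "a - c"] assms by simp
  then show ?thesis using T.invol in_V by metis
qed

lemma chord_shift:
  assumes "b a = \<sigma> (b i)"
  shows "b (a - c) = \<sigma> (b (i + c))"
  using chord_T[OF assms] rotation by simp

lemma chord_shift_nat: "b a = \<sigma> (b i) \<Longrightarrow> b (a - c * int n) = \<sigma> (b (i + c * int n))"
proof (induction n)
  case (Suc n)
  then show ?case
    using chord_shift[of "a - c * int n" "i + c * int n"] by (simp add: algebra_simps)
qed simp

lemma chord_shift_int: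
  assumes "b a = \<sigma> (b i)"
  shows "b (a - c * t) = \<sigma> (b (i + c * t))"
proof (cases "t \<ge> 0")
  case True
  then show ?thesis using chord_shift_nat[OF assms, of "nat t"] by simp
next
  case False
  then show ?thesis
    using chord_sym[OF chord_shift_nat[OF chord_sym[OF assms], of "nat (- t)"]] by simp
qed

text \<open>Shifts by \<open>L\<close> are trivial, so by Bezout's identity the shifts by
  \<open>c\<close> generate those by the gcd.\<close>

lemma chord_shift_gcd:
  assumes "b a = \<sigma> (b i)"
  shows "b (a - gcd c L * t) = \<sigma> (b (i + gcd c L * t))"
proof -
  obtain x y where xy: "x * c + y * L = gcd c L"
    using bezout_int by blast
  have "gcd c L * t = c * (x * t) + L * (y * t)"
    unfolding xy[symmetric] by (simp add: algebra_simps)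
  then show ?thesis
    using chord_period[OF chord_shift_int[OF assms, of "x * t"], of "- (y * t)" "y * t"]
    by (simp add: algebra_simps)
qed

text \<open>Otherwise chords are stable under shifts by a proper divisor \<open>g\<close> of
  \<open>L\<close>. A long chord and its shift by \<open>g\<close> then meet in a fixed point or do
  not cross, and in the latter case symmetry leads to a forbidden reversal.\<close>

lemma rotation_trivial: "L dvd c"
proof (rule ccontr)
  assume ndvd: "\<not> L dvd c"
  define g where "g = gcd c L"
  note shift = chord_shift_gcd[folded g_def]
  note noncrossing = S.noncrossing_chords[OF cyc]
  have g_pos: "g > 0"
    using pos by (simp add: g_def)
  obtain m where m: "L = g * m"
    unfolding g_def by (meson dvd_def gcd_dvd2)
  have "m > 0"
    using m pos g_pos by (simp add: zero_less_mult_iff)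
  have "m \<noteq> 1"
    using ndvd m unfolding g_def by (metis gcd_dvd1 mult.right_neutral)
  have no_fix: "b i \<noteq> \<sigma> (b i)" for i
    using S.no_fixpoint[OF in_V] by metis
  have no_reflection: False if "\<And>t. b (a - t) = \<sigma> (b (i + t))" "i \<le> a" for i a
    using S.no_reversed_interval[OF cyc that(2)] that(1) by blast
  \<comment> \<open>A chord spanning less than half the cycle is replaced by the one from
    \<open>a\<close> to \<open>i + L\<close>.\<close>
  obtain i a where chord: "b a = \<sigma> (b i)" and ia: "i < a" "a < i + L" "L \<le> 2 * (a - i)"
  proof -
    define a where "a = i0 + (j0 - i0) mod L"
    have a: "b a = \<sigma> (b i0)"
      unfolding chord0[symmetric] eq_iff a_def by (simp only: diff_diff_eq[symmetric] dvd_minus_mod)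
    have "a \<noteq> i0" using no_fix a by metis
    moreover have "0 \<le> (j0 - i0) mod L" "(j0 - i0) mod L < L" using pos by auto
    ultimately have bounds: "i0 < a" "a < i0 + L" by (auto simp: a_def)
    show thesis
    proof (cases "L \<le> 2 * (a - i0)")
      case True
      then show thesis using that a bounds by blast
    next
      case False
      moreover have "b (i0 + L) = \<sigma> (b a)"
        using chord_period[OF chord_sym[OF a], of 1 0] by simp
      ultimately show thesis using that[of "i0 + L" a] bounds by simp
    qed
  qed
  have swapped: "b (i + g) = \<sigma> (b (a - g))"
    using chord_sym[OF shift[OF chord, of 1]] by simp
  \<comment> \<open>The shifted chord is nested in the given one, degenerates to a single vertex, or
    is nested when read from \<open>a - g\<close> to \<open>i + g\<close>.\<close>
  consider "2 * g < a - i" | "2 * g = a - i" | "a - i < 2 * g" by linarith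
  then show False
  proof cases
    case 1
    have base: "b (a - t) = \<sigma> (b (i + t))" if "0 \<le> t" "t \<le> g" for t
      using noncrossing[of i "i + g" "a - g" a t] 1 ia g_pos that chord chord_sym[OF swapped] by simp
    \<comment> \<open>Offsets up to \<open>g\<close> suffice, by stability under shifts by
      \<open>g\<close>.\<close>
    have "b (a - t) = \<sigma> (b (i + t))" for t
    proof -
      have "b (a - t mod g) = \<sigma> (b (i + t mod g))"
        using g_pos by (intro base) (auto simp: less_imp_le)
      from shift[OF this, of "t div g"] show ?thesis
        by (simp add: diff_diff_eq add.assoc)
    qed
    then show False using no_reflection[of a i] ia by simp
  next
    case 2
    then have "a - g = i + g" by simp
    then show False using swapped no_fix by metis
  next
    case 3
    have "L < 4 * g" using 3 ia by presburger
    then have "m < 4" using m g_pos by (simp add: mult.commute)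
    then consider "m = 2" | "m = 3" using \<open>m > 0\<close> \<open>m \<noteq> 1\<close> by linarith
    then show False
    proof cases
      case 1
      have L: "L = 2 * g" using m 1 by simp
      obtain q where q: "c = g * q"
        unfolding g_def by (meson dvd_def gcd_dvd1)
      have "odd q"
        using ndvd q L by (metis dvd_triv_left even_mult_iff evenE mult.assoc mult.commute)
      then obtain p where "q = 2 * p + 1" by (rule oddE)
      then have c: "c = g + L * p" using q L by (simp add: algebra_simps)
      \<comment> \<open>As \<open>c\<close> is congruent to \<open>g\<close> modulo
        \<open>L\<close>, \<open>chord_T\<close> turns the \<sigma>-symmetry between two intervals
        into a \<tau>-reversal of the interval from \<open>i\<close> to
        \<open>a - g\<close>.\<close>
      have "\<tau> (b (i + t)) = b (a - g - t)" if "0 \<le> t" "t \<le> a - g - i" for t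
      proof -
        have "b (a - t) = \<sigma> (b (i + t))"
          using noncrossing[of i "a - g" "i + g" a t] that ia 3 L chord swapped by simp
        from chord_T[OF this] have "\<tau> (b (i + t)) = b (a - t - g - L * p)"
          unfolding c by (simp add: algebra_simps)
        then show ?thesis
          unfolding add_period by (simp add: algebra_simps)
      qed
      then show False
        using T.no_reversed_interval[OF cyc, of i "a - g"] ia L by simp
    next
      case 2
      have L: "L = 3 * g" using m 2 by simp
      have base: "b (a - t) = \<sigma> (b (i + t))" if "0 \<le> t" "t \<le> a - g - i" for t
        using noncrossing[of i "a - g" "i + g" a t] that ia 3 L chord swapped by simp
      have chord': "b (i + L) = \<sigma> (b a)"
        using chord_period[OF chord_sym[OF chord], of 1 0] by simp
      have chord'': "b (a + g) = \<sigma> (b (i + 2 * g))"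
        using chord_period[OF shift[OF chord, of 2], of 1 0] L by (simp add: algebra_simps)
      \<comment> \<open>A second noncrossing pair supplies the remaining offsets: the two interval
        lengths add up to \<open>g\<close>.\<close>
      have base': "b (a + t) = \<sigma> (b (i - t))" if "0 \<le> t" "t \<le> i + 2 * g - a" for t
      proof -
        have "b (i + L - t) = \<sigma> (b (a + t))"
          using noncrossing[of a "i + 2 * g" "a + g" "i + L" t] that ia 3 L chord' chord'' by simp
        from chord_period[OF chord_sym[OF this], of 0 "-1"] show ?thesis
          by (simp add: algebra_simps)
      qed
      have "b (a - t) = \<sigma> (b (i + t))" for t
      proof (cases "t mod g \<le> a - g - i")
        case True
        have "b (a - t mod g) = \<sigma> (b (i + t mod g))"
          using g_pos True by (intro base) auto
        from shift[OF this, of "t div g"] show ?thesis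
          by (simp add: diff_diff_eq add.assoc)
      next
        case False
        have "b (a + (g - t mod g)) = \<sigma> (b (i - (g - t mod g)))"
          using g_pos False by (intro base') (auto simp: less_imp_le)
        from shift[OF this, of "t div g + 1"]
        have "b (a - (t mod g + g * (t div g))) = \<sigma> (b (i + (t mod g + g * (t div g))))"
          by (simp add: algebra_simps)
        then show ?thesis by simp
      qed
      then show False using no_reflection[of a i] ia by simp
    qed
  qed
qed

end

lemma skew_unique_on_cycle: "\<tau> (b i) = \<sigma> (b i)"
proof -
  obtain c where c: "\<And>i. \<tau> (b i) = \<sigma> (b (i + c))"
    using images_differ_by_rotation by blast
  then have "L dvd c" by (rule rotation_trivial)
  then have "b (i + c) = b i" by (simp add: eq_iff)
  then show ?thesis using c by simp
qed

end

text \<open>Every vertex lies on the cycle or on its \<sigma>-image, so agreement on the cycle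
  suffices.\<close>

lemma skew_unique:
  assumes "v \<in> V"
  shows "\<tau> v = \<sigma> v"
proof -
  obtain L b i j where cyc: "simple_cycle E L b" and chord: "b j = \<sigma> (b i)"
    using S.ex_simple_contradictory_cycle by blast
  note eq = skew_unique_on_cycle[OF cyc chord]
  note in_V = S.cycle_in_V[OF cyc]
  obtain u where "(u, v) \<in> E \<or> (v, u) \<in> E"
    using assms S.Field_E by (auto simp: Field_def)
  then consider k where "v = b k" | k where "v = \<sigma> (b k)"
    using arc_cases_S[OF cyc chord] by metis
  then show ?thesis
  proof cases
    case 1
    then show ?thesis using eq by simp
  next
    case 2
    have "\<tau> (\<sigma> (b k)) = b k"
      using eq[of k] T.invol[OF in_V[of k]] by simp
    then show ?thesis
      using 2 S.invol[OF in_V[of k]] by simp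
  qed
qed

end

section \<open>Isomorphisms\<close>

text \<open>Conjugation by \<open>f\<close> puts the skew-symmetry of the target on the source
  digraph, where it can be compared with the given one.\<close>

lemma skew_graph_pullback:
  assumes "skew_graph V' E' \<sigma>'" and bij: "bij_betw f V V'" and E_sub: "E \<subseteq> V \<times> V"
    and image: "{(f u, f w) | u w. (u, w) \<in> E} = E'"
  shows "skew_graph V E (\<lambda>v. inv_into V f (\<sigma>' (f v)))"
proof -
  interpret S': skew_graph V' E' \<sigma>' by fact
  define \<tau> where "\<tau> = (\<lambda>v. inv_into V f (\<sigma>' (f v)))"
  have f_in: "f v \<in> V'" if "v \<in> V" for v
    using bij that by (auto simp: bij_betw_def)
  have f_eq: "f u = f w \<longleftrightarrow> u = w" if "u \<in> V" "w \<in> V" for u w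
    using bij that by (auto simp: bij_betw_def inj_on_eq_iff)
  have f_surj: "\<exists>v\<in>V. x = f v" if "x \<in> V'" for x
    using bij that by (auto simp: bij_betw_def)
  have \<tau>_in: "\<tau> v \<in> V" and f_\<tau>: "f (\<tau> v) = \<sigma>' (f v)" if "v \<in> V" for v
    using bij S'.closed[OF f_in[OF that]]
    by (auto simp: \<tau>_def bij_betw_def inv_into_into f_inv_into_f)
  have arc_iff: "(f u, f w) \<in> E' \<longleftrightarrow> (u, w) \<in> E" if "u \<in> V" "w \<in> V" for u w
    using that E_sub unfolding image[symmetric] by (auto simp: f_eq)
  have path_lift: "(u, w) \<in> E\<^sup>*" if "(f u, x) \<in> E'\<^sup>*" "u \<in> V" "w \<in> V" "x = f w" for u w x
    using that
  proof (induction arbitrary: w rule: rtrancl_induct)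
    case base
    then show ?case by (simp add: f_eq)
  next
    case (step y z)
    obtain v where v: "v \<in> V" "y = f v"
      using S'.arc_in_V[OF step.hyps(2)] f_surj by blast
    then have "(v, w) \<in> E"
      using step arc_iff by simp
    then show ?case
      using step.IH[of v] v step.prems by (meson rtrancl.rtrancl_into_rtrancl)
  qed
  have "skew_graph V E \<tau>"
  proof
    show "finite V"
      using S'.finite_V bij bij_betw_finite by blast
    show "Field E = V"
    proof
      show "Field E \<subseteq> V" using E_sub by (auto simp: Field_def)
      show "V \<subseteq> Field E"
      proof
        fix v assume v: "v \<in> V"
        then obtain x where "(f v, x) \<in> E' \<or> (x, f v) \<in> E'"
          using f_in S'.Field_E by (auto simp: Field_def)
        moreover from this obtain w where "w \<in> V" "x = f w"
          using S'.arc_in_V f_surj by blast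
        ultimately show "v \<in> Field E"
          using v arc_iff by (auto simp: Field_def)
      qed
    qed
    show "\<tau> v \<in> V" if "v \<in> V" for v
      using that by (rule \<tau>_in)
    show "\<tau> (\<tau> v) = v" if "v \<in> V" for v
      using that by (simp add: f_eq[symmetric] f_\<tau> \<tau>_in f_in)
    show "\<tau> v \<noteq> v" if "v \<in> V" for v
      using that S'.no_fixpoint[OF f_in[OF that]] by (simp add: f_eq[symmetric] f_\<tau> \<tau>_in)
    show "(v, \<tau> v) \<notin> E" for v
      using S'.no_unit[of "f v"] E_sub arc_iff[of v "\<tau> v"] f_\<tau>[of v] by auto
    show "(\<tau> w, \<tau> u) \<in> E" if "(u, w) \<in> E" for u w
      using that E_sub S'.skew[of "f u" "f w"] by (auto simp: arc_iff[symmetric] f_\<tau> \<tau>_in)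
    obtain x where x: "x \<in> V'" "(x, \<sigma>' x) \<in> E'\<^sup>*" "(\<sigma>' x, x) \<in> E'\<^sup>*"
      using S'.contradictory by blast
    then obtain v where v: "v \<in> V" "x = f v"
      using f_surj by blast
    then have "(v, \<tau> v) \<in> E\<^sup>*" "(\<tau> v, v) \<in> E\<^sup>*"
      using x path_lift \<tau>_in f_\<tau> by metis+
    then show "\<exists>v\<in>V. (v, \<tau> v) \<in> E\<^sup>* \<and> (\<tau> v, v) \<in> E\<^sup>*"
      using v by blast
  next
    fix u w v
    define R where "R = E - {(u, w), (\<tau> w, \<tau> u)}"
    define R' where "R' = E' - {(f u, f w), (\<sigma>' (f w), \<sigma>' (f u))}"
    assume uw: "(u, w) \<in> E" and v: "v \<in> V"
      and "(v, \<tau> v) \<in> (E - {(u, w), (\<tau> w, \<tau> u)})\<^sup>*" "(\<tau> v, v) \<in> (E - {(u, w), (\<tau> w, \<tau> u)})\<^sup>*"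
    then have paths: "(v, \<tau> v) \<in> R\<^sup>*" "(\<tau> v, v) \<in> R\<^sup>*"
      by (simp_all add: R_def)
    have uwV: "u \<in> V" "w \<in> V" using uw E_sub by auto
    have arc_map: "(f x, f y) \<in> R'" if "(x, y) \<in> R" for x y
    proof -
      have "x \<in> V" "y \<in> V" using that E_sub by (auto simp: R_def)
      then show ?thesis
        using that uwV by (simp add: R_def R'_def f_\<tau>[symmetric] f_eq \<tau>_in arc_iff)
    qed
    have "(f x, f y) \<in> R'\<^sup>*" if "(x, y) \<in> R\<^sup>*" for x y
      using that by (induction rule: rtrancl_induct) (auto intro: arc_map rtrancl_into_rtrancl)
    from this[OF paths(1)] this[OF paths(2)] show False
      using S'.minimal[of "f u" "f w" "f v"] uw uwV v by (simp add: R'_def arc_iff f_\<tau> f_in)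
  qed
  then show ?thesis unfolding \<tau>_def .
qed

lemma clause_pair:
  assumes "two_cnf F" "minimally_unsatisfiable F" "deficiency F \<ge> 2" "C \<in> F"
  obtains x y where "C = {x, y}" "x \<noteq> y"
proof -
  have "\<not> card C \<le> 1"
    using deficiency_eq_1_if_small_clause assms by fastforce
  moreover have "card C \<le> 2"
    using assms unfolding two_cnf_def by auto
  ultimately have "card C = 2" by simp
  then show ?thesis
    using that by (meson card_2_iff)
qed

lemma idg_arc_in_lits:
  assumes "(u, w) \<in> parcs (idg F)"
  shows "u \<in> lits F" "w \<in> lits F"
  using assms in_litsI[of "complement u" "{complement u, w}" F] in_litsI[of w "{complement u, w}" F]
  by (simp_all add: idg_arc_iff)

lemma skew_graph_idg:
  assumes cnf: "two_cnf F" and mu: "minimally_unsatisfiable F" and def: "deficiency F \<ge> 2"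
  shows "skew_graph (lits F) (parcs (idg F)) complement"
proof
  note pair = clause_pair[OF cnf mu def]
  show "finite (lits F)"
    using cnf by (rule finite_lits)
  show "Field (parcs (idg F)) = lits F"
  proof
    show "Field (parcs (idg F)) \<subseteq> lits F"
      using idg_arc_in_lits by (auto simp: Field_def)
    show "lits F \<subseteq> Field (parcs (idg F))"
    proof
      fix v assume "v \<in> lits F"
      then obtain C z where z: "C \<in> F" "z \<in> C" "var_of v = var_of z"
        unfolding lits_def vars_def by auto
      obtain x y where "C = {x, y}"
        using pair[OF z(1)] by blast
      with z(2) obtain y' where "C = {z, y'}"
        by blast
      then have "(complement z, y') \<in> parcs (idg F)" "(complement y', z) \<in> parcs (idg F)"
        using z(1) by (simp_all add: idg_arc_iff insert_commute)
      moreover have "v = z \<or> v = complement z"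
        using z(3) by (simp add: var_of_eq_iff)
      ultimately show "v \<in> Field (parcs (idg F))"
        by (auto simp: Field_def)
    qed
  qed
  show "(v, complement v) \<notin> parcs (idg F)" for v
  proof
    assume "(v, complement v) \<in> parcs (idg F)"
    then have "{complement v} \<in> F"
      by (simp add: idg_arc_iff)
    then show False
      using pair by (metis doubleton_eq_iff insert_absorb2)
  qed
  show "(complement w, complement u) \<in> parcs (idg F)" if "(u, w) \<in> parcs (idg F)" for u w
    using that by (rule idg_skew)
  show "\<exists>v\<in>lits F. (v, complement v) \<in> (parcs (idg F))\<^sup>* \<and> (complement v, v) \<in> (parcs (idg F))\<^sup>*"
    using cnf mu pair unfolding minimally_unsatisfiable_def
    by (intro unsatisfiable_contradiction) (blast, blast, metis)
  fix u w v
  let ?R = "parcs (idg F) - {(u, w), (complement w, complement u)}"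
  assume uw: "(u, w) \<in> parcs (idg F)" and v: "(v, complement v) \<in> ?R\<^sup>*" "(complement v, v) \<in> ?R\<^sup>*"
  have "satisfiable (F - {{complement u, w}})"
    using uw mu unfolding minimally_unsatisfiable_def by (simp add: idg_arc_iff)
  note no = satisfiable_no_contradiction[OF this, of v]
  \<comment> \<open>The deleted clause contributes only the two removed arcs, so every arc of
    \<open>?R\<close> comes from another clause.\<close>
  have "?R \<subseteq> parcs (idg (F - {{complement u, w}}))"
  proof
    fix e assume "e \<in> ?R"
    then show "e \<in> parcs (idg (F - {{complement u, w}}))"
      by (cases e) (auto simp: idg_arc_iff doubleton_eq_iff dest: arg_cong[of _ _ complement])
  qed
  from rtrancl_mono[OF this] show False
    using no v by blast
qed simp_all

theorem theorem7p8:
  fixes F :: "'v clause_set" and F' :: "'w clause_set" and k :: int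
  assumes "k \<ge> 2"
    and "two_cnf F" and "minimally_unsatisfiable F" and "deficiency F = k"
    and "two_cnf F'" and "minimally_unsatisfiable F'" and "deficiency F' = k"
  shows "cnf_isos F F' = digraph_isos (idg F) (idg F')"
proof -
  have pair: "\<exists>x y. C = {x, y}" if "C \<in> F" for C
    using clause_pair[of F C] assms that by metis
  have pair': "\<exists>x y. C = {x, y}" if "C \<in> F'" for C
    using clause_pair[of F' C] assms that by metis
  have graph: "skew_graph (lits F) (parcs (idg F)) complement"
    and graph': "skew_graph (lits F') (parcs (idg F')) complement"
    using assms by (simp_all add: skew_graph_idg)
  have clauses_iff_arcs: "{f ` C | C. C \<in> F} = F' \<longleftrightarrow>
      {(f u, f w) | u w. (u, w) \<in> parcs (idg F)} = parcs (idg F')"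
    if comp: "\<forall>x\<in>lits F. f (complement x) = complement (f x)" for f
  proof -
    have clause_image: "f ` {x, y} = {complement (f (complement x)), f y}" if "{x, y} \<in> F" for x y
      using comp in_litsI[OF _ that, of x] by simp
    have arcs_image: "{(f u, f w) | u w. (u, w) \<in> parcs (idg F)}
        = {(u', w'). {complement u', w'} \<in> {f ` C | C. C \<in> F}}" (is "?A = ?B")
    proof
      show "?A \<subseteq> ?B"
      proof
        fix e assume "e \<in> ?A"
        then obtain u w where e: "e = (f u, f w)" and uw: "{complement u, w} \<in> F"
          by (auto simp: idg_arc_iff)
        have "{complement (f u), f w} = f ` {complement u, w}"
          using clause_image[OF uw] by simp
        with uw e show "e \<in> ?B" by blast
      qed
      show "?B \<subseteq> ?A"
      proof
        fix e assume "e \<in> ?B"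
        then obtain u' w' C where e: "e = (u', w')" "C \<in> F" "f ` C = {complement u', w'}"
          by auto
        obtain x y where xy: "C = {x, y}"
          using pair e(2) by blast
        have "\<exists>x y. C = {x, y} \<and> f x = complement u' \<and> f y = w'"
          using e(3) xy by (auto simp: doubleton_eq_iff)
        then obtain x y where xy: "C = {x, y}" "f x = complement u'" "f y = w'"
          by blast
        then have "f (complement x) = u'" "(complement x, y) \<in> parcs (idg F)"
          using comp in_litsI[of x C F] e(2) by (simp_all add: idg_arc_iff)
        with xy e(1) show "e \<in> ?A" by blast
      qed
    qed
    define X where "X = {f ` C | C. C \<in> F}"
    \<comment> \<open>Arcs only see sets of this form; as all members of \<open>X\<close> and
      \<open>F'\<close> have it, equal arc sets give equal clause sets.\<close>
    have image_pairs: "\<exists>x y. C = {complement x, y}" if "C \<in> X \<union> F'" for C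
    proof -
      have "\<exists>x y. C = {x, y}"
        using that pair pair' unfolding X_def by fastforce
      then show ?thesis by (metis complement_complement)
    qed
    have arcs': "parcs (idg F') = {(u', w'). {complement u', w'} \<in> F'}"
      by (auto simp: idg_arc_iff)
    have "X = F'" if eq: "{(u', w'). {complement u', w'} \<in> X} = {(u', w'). {complement u', w'} \<in> F'}"
    proof (rule set_eqI)
      fix C
      show "C \<in> X \<longleftrightarrow> C \<in> F'"
      proof (cases "C \<in> X \<union> F'")
        case True
        then obtain x y where C: "C = {complement x, y}"
          using image_pairs by blast
        have "(x, y) \<in> {(u', w'). {complement u', w'} \<in> X}
            \<longleftrightarrow> (x, y) \<in> {(u', w'). {complement u', w'} \<in> F'}"
          by (simp only: eq)
        then show ?thesis by (simp add: C)
      qed simp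
    qed
    then show ?thesis
      unfolding arcs_image arcs' X_def[symmetric] by (intro iffI) simp_all
  qed
  have comp: "\<forall>x\<in>lits F. f (complement x) = complement (f x)"
    if "f \<in> digraph_isos (idg F) (idg F')" for f
  proof
    fix x assume x: "x \<in> lits F"
    have bij: "bij_betw f (lits F) (lits F')"
      and arcs: "{(f u, f w) | u w. (u, w) \<in> parcs (idg F)} = parcs (idg F')"
      using that by (auto simp: digraph_isos_def idg_def)
    have pullback: "skew_graph (lits F) (parcs (idg F)) (\<lambda>v. inv_into (lits F) f (complement (f v)))"
      by (rule skew_graph_pullback[OF graph' bij _ arcs]) (auto dest: idg_arc_in_lits)
    interpret skew_graph_pair "lits F" "parcs (idg F)" complement
      "\<lambda>v. inv_into (lits F) f (complement (f v))"
      by (rule skew_graph_pair.intro[OF graph pullback])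
    have "complement (f x) \<in> f ` lits F"
      using bij x by (auto simp: bij_betw_def)
    \<comment> \<open>Uniqueness identifies \<open>complement x\<close> with the preimage of
      \<open>complement (f x)\<close> under \<open>f\<close>.\<close>
    from f_inv_into_f[OF this] show "f (complement x) = complement (f x)"
      unfolding skew_unique[OF x] .
  qed
  have verts: "pverts (idg F) = lits F" "pverts (idg F') = lits F'"
    by (simp_all add: idg_def)
  show ?thesis
  proof (intro set_eqI iffI)
    fix f assume "f \<in> cnf_isos F F'"
    then have f: "f \<in> extensional (lits F)" "bij_betw f (lits F) (lits F')"
      "\<forall>x\<in>lits F. f (complement x) = complement (f x)" "{f ` C | C. C \<in> F} = F'"
      by (simp_all add: cnf_isos_def)
    have "{(f u, f w) | u w. (u, w) \<in> parcs (idg F)} = parcs (idg F')"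
      using clauses_iff_arcs[OF f(3)] f(4) by (rule iffD1)
    with f(1,2) show "f \<in> digraph_isos (idg F) (idg F')"
      unfolding digraph_isos_def verts by (intro CollectI conjI)
  next
    fix f assume f: "f \<in> digraph_isos (idg F) (idg F')"
    then have iso: "f \<in> extensional (lits F)" "bij_betw f (lits F) (lits F')"
      "{(f u, f w) | u w. (u, w) \<in> parcs (idg F)} = parcs (idg F')"
      by (simp_all add: digraph_isos_def verts)
    have "{f ` C | C. C \<in> F} = F'"
      using clauses_iff_arcs[OF comp[OF f]] iso(3) by (rule iffD2)
    with iso(1,2) comp[OF f] show "f \<in> cnf_isos F F'"
      unfolding cnf_isos_def by (intro CollectI conjI)
  qed
qed

end
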